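(* Let $k\ge2$, $m\ge0$, $1\le s\le k$, and $N=mk+s$. The numbers of permutations in $\mathcal{D}_{N,k}$ avoiding the fully consecutive patterns of length three are as follows. (1) $|\mathcal{D}_{N,k}(\underline{123})|=0$ if $k\ge3$ and $N\ge3$; and $\mathcal{D}_{N,k}(\underline{123})=\mathcal{D}_{N,k}$ if $N<3$ or $k=2$. (2) $|\mathcal{D}_{N,k}(\underline{321})|=|\mathcal{D}_{N,k}|$. (3) $|\mathcal{D}_{N,k}(\underline{312})|=k^m\,m!$. (4) $|\mathcal{D}_{N,k}(\underline{231})|=\prod_{j=0}^{m-1}(s+jk)$. (5) $|\mathcal{D}_{N,k}(\underline{132})|=\operatorname{LE}(P^{132}_{m,s,k})$, where $P^{132}_{m,s,k}$ is the poset obtained from the block poset $B_{m,s,k}$ by adding the relations $x_{i+1,1}<x_{i,k-1}$ for $1\le i\le m$, whenever $x_{i,k-1}$ exists. (6) $|\mathcal{D}_{N,k}(\underline{213})|=\operatorname{LE}(P^{213}_{m,s,k})$, where $P^{213}_{m,s,k}$ is the poset obtained from $B_{m,s,k}$ by adding the relations $x_{i+1,2}<x_{i,k}$ for $1\le i\le m$, whenever $x_{i+1,2}$ exists.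
   Context: For $\pi=\pi_1\cdots\pi_N\in S_N$ let $\operatorname{Des}(\pi)=\{i\in[N-1]:\pi_i>\pi_{i+1}\}$. For $k\ge2$, $N\ge1$, let $\mathcal{D}_{N,k}=\{\pi\in S_N:\operatorname{Des}(\pi)=\{k,2k,\ldots,k\lfloor (N-1)/k\rfloor\}\}$. For $p\in S_3$, $\underline{p}$ denotes the fully consecutive pattern: $\pi$ contains $\underline{p}$ if some three entries in consecutive positions $\pi_i\pi_{i+1}\pi_{i+2}$ have the same relative order as $p$, and otherwise avoids it; $\mathcal{D}_{N,k}(\underline{p})$ is the set of elements of $\mathcal{D}_{N,k}$ avoiding $\underline{p}$. Empty products equal $1$. Write $N=mk+s$ with $1\le s\le k$, and split the positions $1,\ldots,N$ from left to right into $m$ blocks of length $k$ followed by a last block of length $s$; $x_{i,a}$ is the $a$-th position of the $i$-th block ($1\le a\le k$ for $i\le m$, $1\le a\le s$ for $i=m+1$). The block poset $B_{m,s,k}$ on the elements $x_{i,a}$ is generated by $x_{i,a}<x_{i,a+1}$ inside each block and $x_{i+1,1}<x_{i,k}$ for $1\le i\le m$. "Adding relations" to a poset means taking the transitive closure. $\operatorname{LE}(P)$ is the number of linear extensions of a finite poset $P$. *)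

theory Defs
  imports "HOL-Combinatorics.Combinatorics"
begin

text \<open>Elements of \<open>S\<^sub>N\<close> are functions that permute \<open>{1..N}\<close>, with \<open>\<pi> i\<close> the \<open>i\<close>-th entry
  (positions start at 1).\<close>

definition Des :: "nat \<Rightarrow> (nat \<Rightarrow> nat) \<Rightarrow> nat set" where
  "Des N \<pi> = {i \<in> {1..<N}. \<pi> i > \<pi> (i + 1)}"

definition desc_perms :: "nat \<Rightarrow> nat \<Rightarrow> (nat \<Rightarrow> nat) set" where
  "desc_perms N k =
    {\<pi>. \<pi> permutes {1..N} \<and> Des N \<pi> = (\<lambda>j. k * j) ` {1..(N - 1) div k}}"

text \<open>A pattern is given in one-line notation, as the list of its entries; list indices start
  at 0, so the window beginning at position \<open>i\<close> consists of the positions \<open>i + a\<close> with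
  \<open>a < length p\<close>.\<close>

definition contains_consecutive :: "nat \<Rightarrow> (nat \<Rightarrow> nat) \<Rightarrow> nat list \<Rightarrow> bool" where
  "contains_consecutive N \<pi> p \<longleftrightarrow>
    (\<exists>i \<ge> 1. i + length p \<le> N + 1 \<and>
      (\<forall>a < length p. \<forall>b < length p. \<pi> (i + a) < \<pi> (i + b) \<longleftrightarrow> p ! a < p ! b))"

definition desc_perms_avoiding :: "nat \<Rightarrow> nat \<Rightarrow> nat list \<Rightarrow> (nat \<Rightarrow> nat) set" where
  "desc_perms_avoiding N k p = {\<pi> \<in> desc_perms N k. \<not> contains_consecutive N \<pi> p}"

text \<open>A finite poset is a carrier together with its reflexive order relation, a pair \<open>(x, y)\<close>
  meaning that \<open>x\<close> is below \<open>y\<close>. A linear extension is a linear order on the carrier that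
  contains the given order.\<close>

definition linear_extensions :: "'a set \<Rightarrow> 'a rel \<Rightarrow> 'a rel set" where
  "linear_extensions A r = {l. linear_order_on A l \<and> r \<subseteq> l}"

definition LE :: "'a set \<Rightarrow> 'a rel \<Rightarrow> nat" where
  "LE A r = card (linear_extensions A r)"

definition generated_order :: "'a set \<Rightarrow> 'a rel \<Rightarrow> 'a rel" where
  "generated_order A g = Id_on A \<union> g\<^sup>+"

definition add_relations :: "'a rel \<Rightarrow> 'a rel \<Rightarrow> 'a rel" where
  "add_relations r q = (r \<union> q)\<^sup>+"

text \<open>The element \<open>x\<^bsub>i,a\<^esub>\<close> is the pair \<open>(i, a)\<close>.\<close>

definition block_elems :: "nat \<Rightarrow> nat \<Rightarrow> nat \<Rightarrow> (nat \<times> nat) set" where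
  "block_elems m s k =
    {(i, a). 1 \<le> i \<and> i \<le> m + 1 \<and> 1 \<le> a \<and> a \<le> (if i \<le> m then k else s)}"

definition block_poset :: "nat \<Rightarrow> nat \<Rightarrow> nat \<Rightarrow> (nat \<times> nat) rel" where
  "block_poset m s k = generated_order (block_elems m s k)
    ({((i, a), (i, a + 1)) | i a. (i, a) \<in> block_elems m s k \<and> (i, a + 1) \<in> block_elems m s k}
     \<union> {((i + 1, 1), (i, k)) | i. 1 \<le> i \<and> i \<le> m})"

definition poset132 :: "nat \<Rightarrow> nat \<Rightarrow> nat \<Rightarrow> (nat \<times> nat) rel" where
  "poset132 m s k = add_relations (block_poset m s k)
    {((i + 1, 1), (i, k - 1)) | i. 1 \<le> i \<and> i \<le> m \<and> (i, k - 1) \<in> block_elems m s k}"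

definition poset213 :: "nat \<Rightarrow> nat \<Rightarrow> nat \<Rightarrow> (nat \<times> nat) rel" where
  "poset213 m s k = add_relations (block_poset m s k)
    {((i + 1, 2), (i, k)) | i. 1 \<le> i \<and> i \<le> m \<and> (i + 1, 2) \<in> block_elems m s k}"

text \<open>Both constructions yield partial orders: every generating relation goes to an earlier
  block or, within a block, to a later place, so no cycle arises.\<close>

definition block_before :: "(nat \<times> nat) rel" where
  "block_before = {((i, a), (j, b)). j < i \<or> (j = i \<and> a < b)}"

lemma partial_order_on_add_relations_generated:
  assumes g: "g \<subseteq> A \<times> A" "g \<subseteq> block_before"
    and q: "q \<subseteq> A \<times> A" "q \<subseteq> block_before"
  shows "partial_order_on A (add_relations (generated_order A g) q)"
proof -
  have trb: "trans block_before"
    by (auto simp: block_before_def trans_def)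
  have trbi: "trans (block_before \<union> Id)"
    using trb by (auto simp: trans_def)
  have irr: "(x, x) \<notin> block_before" for x
    by (auto simp: block_before_def)
  let ?h = "generated_order A g \<union> q"
  have "g\<^sup>+ \<subseteq> block_before"
    using g(2) trb by (metis trancl_id trancl_mono_subset)
  then have "?h \<subseteq> block_before \<union> Id"
    using q(2) unfolding generated_order_def by auto
  then have "?h\<^sup>+ \<subseteq> block_before \<union> Id"
    using trbi by (metis trancl_id trancl_mono_subset)
  then have "antisym (?h\<^sup>+)"
    using trb irr by (auto simp: antisym_def trans_def) blast+
  moreover have "?h \<subseteq> A \<times> A"
    using trancl_subset_Sigma[OF g(1)] q(1) unfolding generated_order_def by auto
  then have "?h\<^sup>+ \<subseteq> A \<times> A"
    by (rule trancl_subset_Sigma)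
  moreover have "Id_on A \<subseteq> ?h\<^sup>+"
    unfolding generated_order_def by auto
  ultimately show ?thesis
    unfolding add_relations_def partial_order_on_def preorder_on_def
    by (auto simp: refl_on_def)
qed

lemma partial_order_on_poset132:
  assumes "k \<ge> 2" "1 \<le> s" "s \<le> k"
  shows "partial_order_on (block_elems m s k) (poset132 m s k)"
  unfolding poset132_def block_poset_def
  by (rule partial_order_on_add_relations_generated)
    (use assms in \<open>auto simp: block_elems_def block_before_def\<close>)

lemma partial_order_on_poset213:
  assumes "k \<ge> 2" "1 \<le> s" "s \<le> k"
  shows "partial_order_on (block_elems m s k) (poset213 m s k)"
  unfolding poset213_def block_poset_def
  by (rule partial_order_on_add_relations_generated)
    (use assms in \<open>auto simp: block_elems_def block_before_def\<close>)

end

theory Submission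
  imports Defs
begin

text \<open>Since no two descents are adjacent, a window of three entries can only show \<open>312\<close> or \<open>213\<close>
  when its first position is a descent, and \<open>231\<close> or \<open>132\<close> when its middle position is one. So
  avoiding one of these patterns amounts to comparing \<open>\<pi> i\<close> with \<open>\<pi> (i + 2)\<close> at every such
  window, and this comparison is a relation between elements of the block poset, which gives the
  counts for \<open>132\<close> and \<open>213\<close>.

  For \<open>312\<close> and any set \<open>D\<close> of descents without adjacent elements, build the permutation by
  appending entries on the right. The maximum of the first \<open>n\<close> entries sits at position \<open>n\<close>, or
  at position \<open>n - 1\<close> if \<open>n - 1\<close> is a descent. Hence the new entry must be the new maximum if
  \<open>n\<close> is not a descent, and it can be any of the \<open>n\<close> other values if it is one. The count is
  therefore the product of the descents. Reversing and complementing turns \<open>231\<close> into \<open>312\<close> and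
  a descent \<open>d\<close> into \<open>N - d\<close>.\<close>

section \<open>Permutations with a given descent set\<close>

text \<open>Only the elements of \<open>D\<close> in \<open>{1..<N}\<close> are consulted, so one
  set, such as all multiples of \<open>k\<close>, serves every length and stays fixed while entries
  are appended.\<close>

definition des_perms :: "nat \<Rightarrow> nat set \<Rightarrow> (nat \<Rightarrow> nat) set" where
  "des_perms N D = {\<pi>. \<pi> permutes {1..N} \<and> (\<forall>i\<in>{1..<N}. \<pi> (i + 1) < \<pi> i \<longleftrightarrow> i \<in> D)}"

definition des_perms_312 :: "nat \<Rightarrow> nat set \<Rightarrow> (nat \<Rightarrow> nat) set" where
  "des_perms_312 N D =
    {\<pi> \<in> des_perms N D. \<forall>i. 1 \<le> i \<and> i + 2 \<le> N \<and> i \<in> D \<longrightarrow> \<pi> i < \<pi> (i + 2)}"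

definition des_perms_231 :: "nat \<Rightarrow> nat set \<Rightarrow> (nat \<Rightarrow> nat) set" where
  "des_perms_231 N D =
    {\<pi> \<in> des_perms N D. \<forall>i. 1 \<le> i \<and> i + 2 \<le> N \<and> i + 1 \<in> D \<longrightarrow> \<pi> i < \<pi> (i + 2)}"

lemma permutes_neq: "\<pi> permutes S \<Longrightarrow> i \<noteq> j \<Longrightarrow> \<pi> i \<noteq> \<pi> j"
  by (meson injD permutes_inj)

lemma des_perms_ascent:
  assumes "\<pi> \<in> des_perms N D" "1 \<le> i" "i < N" "i \<notin> D"
  shows "\<pi> i < \<pi> (i + 1)"
  using assms permutes_neq[of \<pi> "{1..N}" i "i + 1"]
  unfolding des_perms_def by fastforce

text \<open>Divisibility describes the descents independently of \<open>N\<close>; the image is the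
  form used in \<open>desc_perms\<close> and the one over which products are later
  reindexed.\<close>

lemma multiples_eq_image:
  fixes k N :: nat
  assumes "k \<ge> 1"
  shows "{i. k dvd i} \<inter> {1..<N} = (\<lambda>j. k * j) ` {1..(N - 1) div k}"
proof (intro equalityI subsetI)
  fix i assume "i \<in> {i. k dvd i} \<inter> {1..<N}"
  then obtain j where j: "i = k * j" "1 \<le> i" "i < N" by (auto elim: dvdE)
  then have "k * j \<le> N - 1" by linarith
  moreover have "1 \<le> j" using j by (cases j) simp_all
  ultimately have "j \<le> (N - 1) div k" "1 \<le> j"
    using assms by (auto simp: less_eq_div_iff_mult_less_eq mult.commute)
  then show "i \<in> (\<lambda>j. k * j) ` {1..(N - 1) div k}" using j by auto
next
  fix i assume "i \<in> (\<lambda>j. k * j) ` {1..(N - 1) div k}"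
  then obtain j where i: "i = k * j" and "j \<in> {1..(N - 1) div k}" by (rule imageE)
  then have j: "1 \<le> j" "j \<le> (N - 1) div k" by simp_all
  then have "k * j \<le> N - 1"
    using assms by (simp add: less_eq_div_iff_mult_less_eq mult.commute)
  moreover have "1 \<le> k * j" using assms j by simp
  ultimately have "i < N" "1 \<le> i" unfolding i by linarith+
  then show "i \<in> {i. k dvd i} \<inter> {1..<N}" using i by simp
qed

lemma desc_perms_eq_des_perms:
  assumes "k \<ge> 1"
  shows "desc_perms N k = des_perms N {i. k dvd i}"
proof -
  have "{i \<in> {1..<N}. \<pi> i > \<pi> (i + 1)} = {i. k dvd i} \<inter> {1..<N} \<longleftrightarrow>
      (\<forall>i\<in>{1..<N}. \<pi> (i + 1) < \<pi> i \<longleftrightarrow> i \<in> {i. k dvd i})" for \<pi> :: "nat \<Rightarrow> nat"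
    by blast
  then show ?thesis
    unfolding desc_perms_def des_perms_def Des_def multiples_eq_image[OF assms, symmetric] by simp
qed

section \<open>Consecutive patterns of length three as local comparisons\<close>

lemma contains_consecutive_3:
  "contains_consecutive N \<pi> [p, q, r] \<longleftrightarrow>
    (\<exists>i. 1 \<le> i \<and> i + 2 \<le> N \<and>
      (\<pi> i < \<pi> (i + 1) \<longleftrightarrow> p < q) \<and> (\<pi> (i + 1) < \<pi> i \<longleftrightarrow> q < p) \<and>
      (\<pi> i < \<pi> (i + 2) \<longleftrightarrow> p < r) \<and> (\<pi> (i + 2) < \<pi> i \<longleftrightarrow> r < p) \<and>
      (\<pi> (i + 1) < \<pi> (i + 2) \<longleftrightarrow> q < r) \<and> (\<pi> (i + 2) < \<pi> (i + 1) \<longleftrightarrow> r < q))"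
proof -
  have len: "length [p, q, r] = 3" by simp
  have all3: "(\<forall>a < 3. P a) \<longleftrightarrow> P 0 \<and> P 1 \<and> P 2" for P :: "nat \<Rightarrow> bool"
    by (auto simp: numeral_3_eq_3 numeral_2_eq_2 less_Suc_eq)
  have "i + 3 \<le> N + 1 \<longleftrightarrow> i + 2 \<le> N" for i by auto
  then show ?thesis
    unfolding contains_consecutive_def len all3
    by (intro ex_cong1) (auto simp: numeral_2_eq_2)
qed

text \<open>For 123 and 321 the comparison of the outer entries follows by transitivity. For the
  other four patterns it is independent of the adjacent comparisons; it is stated negated, so that
  avoidance becomes a positive inequality between \<pi> i and \<pi> (i + 2).\<close>

lemma
  assumes "\<pi> permutes {1..N}"
  shows contains_312: "contains_consecutive N \<pi> [3, 1, 2] \<longleftrightarrow>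
      (\<exists>i. 1 \<le> i \<and> i + 2 \<le> N \<and> \<pi> (i + 1) < \<pi> i \<and> \<pi> (i + 1) < \<pi> (i + 2) \<and> \<not> \<pi> i < \<pi> (i + 2))"
    and contains_213: "contains_consecutive N \<pi> [2, 1, 3] \<longleftrightarrow>
      (\<exists>i. 1 \<le> i \<and> i + 2 \<le> N \<and> \<pi> (i + 1) < \<pi> i \<and> \<pi> (i + 1) < \<pi> (i + 2) \<and> \<not> \<pi> (i + 2) < \<pi> i)"
    and contains_231: "contains_consecutive N \<pi> [2, 3, 1] \<longleftrightarrow>
      (\<exists>i. 1 \<le> i \<and> i + 2 \<le> N \<and> \<pi> i < \<pi> (i + 1) \<and> \<pi> (i + 2) < \<pi> (i + 1) \<and> \<not> \<pi> i < \<pi> (i + 2))"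
    and contains_132: "contains_consecutive N \<pi> [1, 3, 2] \<longleftrightarrow>
      (\<exists>i. 1 \<le> i \<and> i + 2 \<le> N \<and> \<pi> i < \<pi> (i + 1) \<and> \<pi> (i + 2) < \<pi> (i + 1) \<and> \<not> \<pi> (i + 2) < \<pi> i)"
    and contains_123: "contains_consecutive N \<pi> [1, 2, 3] \<longleftrightarrow>
      (\<exists>i. 1 \<le> i \<and> i + 2 \<le> N \<and> \<pi> i < \<pi> (i + 1) \<and> \<pi> (i + 1) < \<pi> (i + 2))"
    and contains_321: "contains_consecutive N \<pi> [3, 2, 1] \<longleftrightarrow>
      (\<exists>i. 1 \<le> i \<and> i + 2 \<le> N \<and> \<pi> (i + 1) < \<pi> i \<and> \<pi> (i + 2) < \<pi> (i + 1))"
proof -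
  have "\<pi> i \<noteq> \<pi> (i + 2)" for i
    using permutes_neq[OF assms, of i "i + 2"] by simp
  then have ne: "\<pi> i < \<pi> (i + 2) \<longleftrightarrow> \<not> \<pi> (i + 2) < \<pi> i" for i
    by (metis nat_neq_iff less_asym)
  show "contains_consecutive N \<pi> [3, 1, 2] \<longleftrightarrow>
      (\<exists>i. 1 \<le> i \<and> i + 2 \<le> N \<and> \<pi> (i + 1) < \<pi> i \<and> \<pi> (i + 1) < \<pi> (i + 2) \<and> \<not> \<pi> i < \<pi> (i + 2))"
    unfolding contains_consecutive_3 ne by (rule ex_cong1) auto
  show "contains_consecutive N \<pi> [2, 1, 3] \<longleftrightarrow>
      (\<exists>i. 1 \<le> i \<and> i + 2 \<le> N \<and> \<pi> (i + 1) < \<pi> i \<and> \<pi> (i + 1) < \<pi> (i + 2) \<and> \<not> \<pi> (i + 2) < \<pi> i)"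
    unfolding contains_consecutive_3 ne by (rule ex_cong1) auto
  show "contains_consecutive N \<pi> [2, 3, 1] \<longleftrightarrow>
      (\<exists>i. 1 \<le> i \<and> i + 2 \<le> N \<and> \<pi> i < \<pi> (i + 1) \<and> \<pi> (i + 2) < \<pi> (i + 1) \<and> \<not> \<pi> i < \<pi> (i + 2))"
    unfolding contains_consecutive_3 ne by (rule ex_cong1) auto
  show "contains_consecutive N \<pi> [1, 3, 2] \<longleftrightarrow>
      (\<exists>i. 1 \<le> i \<and> i + 2 \<le> N \<and> \<pi> i < \<pi> (i + 1) \<and> \<pi> (i + 2) < \<pi> (i + 1) \<and> \<not> \<pi> (i + 2) < \<pi> i)"
    unfolding contains_consecutive_3 ne by (rule ex_cong1) auto
  show "contains_consecutive N \<pi> [1, 2, 3] \<longleftrightarrow>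
      (\<exists>i. 1 \<le> i \<and> i + 2 \<le> N \<and> \<pi> i < \<pi> (i + 1) \<and> \<pi> (i + 1) < \<pi> (i + 2))"
    unfolding contains_consecutive_3 by (rule ex_cong1) auto
  show "contains_consecutive N \<pi> [3, 2, 1] \<longleftrightarrow>
      (\<exists>i. 1 \<le> i \<and> i + 2 \<le> N \<and> \<pi> (i + 1) < \<pi> i \<and> \<pi> (i + 2) < \<pi> (i + 1))"
    unfolding contains_consecutive_3 by (rule ex_cong1) auto
qed

text \<open>A descent at \<open>i\<close> is followed by an ascent, and a descent at
  \<open>i + 1\<close> is preceded by one, so \<open>D\<close> alone locates valleys and peaks. The
  bounds on \<open>i\<close> are repeated on both sides so that the equivalences can be applied
  under the existential quantifier.\<close>

lemma
  assumes \<pi>: "\<pi> \<in> des_perms N D" and D: "\<And>i. i \<in> D \<Longrightarrow> i + 1 \<notin> D"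
  shows valley_iff: "1 \<le> i \<and> i + 2 \<le> N \<and> \<pi> (i + 1) < \<pi> i \<and> \<pi> (i + 1) < \<pi> (i + 2)
      \<longleftrightarrow> 1 \<le> i \<and> i + 2 \<le> N \<and> i \<in> D"
    and peak_iff: "1 \<le> i \<and> i + 2 \<le> N \<and> \<pi> i < \<pi> (i + 1) \<and> \<pi> (i + 2) < \<pi> (i + 1)
      \<longleftrightarrow> 1 \<le> i \<and> i + 2 \<le> N \<and> i + 1 \<in> D"
proof -
  have des: "\<pi> (j + 1) < \<pi> j \<longleftrightarrow> j \<in> D" if "1 \<le> j" "j < N" for j
    using \<pi> that unfolding des_perms_def by auto
  have asc: "\<pi> j < \<pi> (j + 1)" if "1 \<le> j" "j < N" "j \<notin> D" for j
    using des_perms_ascent[OF \<pi> that] .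
  show "1 \<le> i \<and> i + 2 \<le> N \<and> \<pi> (i + 1) < \<pi> i \<and> \<pi> (i + 1) < \<pi> (i + 2)
      \<longleftrightarrow> 1 \<le> i \<and> i + 2 \<le> N \<and> i \<in> D"
    using des[of i] asc[of "i + 1"] D[of i] by auto
  show "1 \<le> i \<and> i + 2 \<le> N \<and> \<pi> i < \<pi> (i + 1) \<and> \<pi> (i + 2) < \<pi> (i + 1)
      \<longleftrightarrow> 1 \<le> i \<and> i + 2 \<le> N \<and> i + 1 \<in> D"
    using des[of "i + 1"] asc[of i] D[of i] by (cases "i \<in> D") auto
qed

lemma
  assumes "k \<ge> 2"
  shows avoiding_312: "desc_perms_avoiding N k [3, 1, 2] = des_perms_312 N {i. k dvd i}"
    and avoiding_231: "desc_perms_avoiding N k [2, 3, 1] = des_perms_231 N {i. k dvd i}"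
    and avoiding_132: "desc_perms_avoiding N k [1, 3, 2] =
      {\<pi> \<in> des_perms N {i. k dvd i}.
        \<forall>i. 1 \<le> i \<and> i + 2 \<le> N \<and> k dvd i + 1 \<longrightarrow> \<pi> (i + 2) < \<pi> i}"
    and avoiding_213: "desc_perms_avoiding N k [2, 1, 3] =
      {\<pi> \<in> des_perms N {i. k dvd i}. \<forall>i. 1 \<le> i \<and> i + 2 \<le> N \<and> k dvd i \<longrightarrow> \<pi> (i + 2) < \<pi> i}"
    and avoiding_321: "desc_perms_avoiding N k [3, 2, 1] = desc_perms N k"
    and avoiding_123: "desc_perms_avoiding N k [1, 2, 3] =
      (if N < 3 \<or> k = 2 then desc_perms N k else {})"
proof -
  let ?D = "{i. k dvd i}"
  \<comment> \<open>If \<open>k\<close> divided both numbers it would divide 1.\<close>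
  have D: "i + 1 \<notin> ?D" if "i \<in> ?D" for i
    using that assms dvd_add_right_iff[of k i 1] by auto
  have eq: "desc_perms N k = des_perms N ?D"
    using assms by (intro desc_perms_eq_des_perms) simp
  have perm: "\<pi> permutes {1..N}" if "\<pi> \<in> des_perms N ?D" for \<pi>
    using that by (simp add: des_perms_def)
  have "contains_consecutive N \<pi> [3, 1, 2] \<longleftrightarrow>
      (\<exists>i. 1 \<le> i \<and> i + 2 \<le> N \<and> k dvd i \<and> \<not> \<pi> i < \<pi> (i + 2))"
    if "\<pi> \<in> des_perms N ?D" for \<pi>
    unfolding contains_312[OF perm[OF that]] using valley_iff[OF that D] by blast
  then show "desc_perms_avoiding N k [3, 1, 2] = des_perms_312 N ?D"
    unfolding desc_perms_avoiding_def des_perms_312_def eq by auto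
  have "contains_consecutive N \<pi> [2, 1, 3] \<longleftrightarrow>
      (\<exists>i. 1 \<le> i \<and> i + 2 \<le> N \<and> k dvd i \<and> \<not> \<pi> (i + 2) < \<pi> i)"
    if "\<pi> \<in> des_perms N ?D" for \<pi>
    unfolding contains_213[OF perm[OF that]] using valley_iff[OF that D] by blast
  then show "desc_perms_avoiding N k [2, 1, 3] =
      {\<pi> \<in> des_perms N ?D. \<forall>i. 1 \<le> i \<and> i + 2 \<le> N \<and> k dvd i \<longrightarrow> \<pi> (i + 2) < \<pi> i}"
    unfolding desc_perms_avoiding_def eq by auto
  have "contains_consecutive N \<pi> [2, 3, 1] \<longleftrightarrow>
      (\<exists>i. 1 \<le> i \<and> i + 2 \<le> N \<and> k dvd i + 1 \<and> \<not> \<pi> i < \<pi> (i + 2))"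
    if "\<pi> \<in> des_perms N ?D" for \<pi>
    unfolding contains_231[OF perm[OF that]] using peak_iff[OF that D] by blast
  then show "desc_perms_avoiding N k [2, 3, 1] = des_perms_231 N ?D"
    unfolding desc_perms_avoiding_def des_perms_231_def eq by auto
  have "contains_consecutive N \<pi> [1, 3, 2] \<longleftrightarrow>
      (\<exists>i. 1 \<le> i \<and> i + 2 \<le> N \<and> k dvd i + 1 \<and> \<not> \<pi> (i + 2) < \<pi> i)"
    if "\<pi> \<in> des_perms N ?D" for \<pi>
    unfolding contains_132[OF perm[OF that]] using peak_iff[OF that D] by blast
  then show "desc_perms_avoiding N k [1, 3, 2] =
      {\<pi> \<in> des_perms N ?D. \<forall>i. 1 \<le> i \<and> i + 2 \<le> N \<and> k dvd i + 1 \<longrightarrow> \<pi> (i + 2) < \<pi> i}"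
    unfolding desc_perms_avoiding_def eq by auto
  have des: "\<pi> (i + 1) < \<pi> i \<longleftrightarrow> k dvd i" if "\<pi> \<in> des_perms N ?D" "1 \<le> i" "i < N" for \<pi> i
    using that unfolding des_perms_def by auto
  have "\<not> contains_consecutive N \<pi> [3, 2, 1]" if \<pi>: "\<pi> \<in> des_perms N ?D" for \<pi>
  proof
    assume "contains_consecutive N \<pi> [3, 2, 1]"
    then obtain i where i: "1 \<le> i" "i + 2 \<le> N" "\<pi> (i + 1) < \<pi> i" "\<pi> (i + 2) < \<pi> (i + 1)"
      unfolding contains_321[OF perm[OF \<pi>]] by blast
    then have "k dvd i" "k dvd i + 1"
      using des[OF \<pi>, of i] des[OF \<pi>, of "i + 1"] by auto
    then show False using D[of i] by simp
  qed
  then show "desc_perms_avoiding N k [3, 2, 1] = desc_perms N k"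
    unfolding desc_perms_avoiding_def eq by auto
  have "contains_consecutive N \<pi> [1, 2, 3] \<longleftrightarrow> \<not> (N < 3 \<or> k = 2)"
    if \<pi>: "\<pi> \<in> des_perms N ?D" for \<pi>
  proof
    assume "contains_consecutive N \<pi> [1, 2, 3]"
    then obtain i where i: "1 \<le> i" "i + 2 \<le> N" "\<pi> i < \<pi> (i + 1)" "\<pi> (i + 1) < \<pi> (i + 2)"
      unfolding contains_123[OF perm[OF \<pi>]] by blast
    then have "\<not> k dvd i" "\<not> k dvd i + 1"
      using des[OF \<pi>, of i] des[OF \<pi>, of "i + 1"] by auto
    \<comment> \<open>For \<open>k = 2\<close> one of \<open>i\<close> and \<open>i + 1\<close>
      would be a multiple of \<open>k\<close>; the window itself needs three positions.\<close>
    then show "\<not> (N < 3 \<or> k = 2)" using i by auto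
  next
    assume "\<not> (N < 3 \<or> k = 2)"
    \<comment> \<open>For \<open>k\<close> at least 3 neither position 1 nor position 2 is a
      descent, so the window at position 1 is increasing.\<close>
    then have "3 \<le> N" "\<not> k dvd 1" "\<not> k dvd 2"
      using assms by (auto dest: dvd_imp_le)
    then show "contains_consecutive N \<pi> [1, 2, 3]"
      unfolding contains_123[OF perm[OF \<pi>]]
      using des_perms_ascent[OF \<pi>, of 1] des_perms_ascent[OF \<pi>, of 2]
      by (intro exI[of _ 1]) (simp add: numeral_2_eq_2)
  qed
  then show "desc_perms_avoiding N k [1, 2, 3] = (if N < 3 \<or> k = 2 then desc_perms N k else {})"
    unfolding desc_perms_avoiding_def eq by auto
qed

section \<open>Counting by appending entries\<close>

text \<open>Composing \<open>raise_above n v\<close> after a permutation of \<open>{1..n}\<close> appends the entry \<open>v\<close> and keeps the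
  relative order of the first \<open>n\<close> entries.\<close>

definition raise_above :: "nat \<Rightarrow> nat \<Rightarrow> nat \<Rightarrow> nat" where
  "raise_above n v i = (if i = n + 1 then v else if v \<le> i \<and> i \<le> n then i + 1 else i)"

lemma raise_above_permutes:
  assumes "1 \<le> v" "v \<le> n + 1"
  shows "raise_above n v permutes {1..n + 1}"
proof (rule bij_imp_permutes)
  have "inj_on (raise_above n v) {1..n + 1}"
    by (auto simp: inj_on_def raise_above_def split: if_splits)
  moreover have "raise_above n v ` {1..n + 1} \<subseteq> {1..n + 1}"
    using assms by (auto simp: raise_above_def)
  ultimately show "bij_betw (raise_above n v) {1..n + 1} {1..n + 1}"
    by (simp add: bij_betw_def endo_inj_surj)
qed (use assms in \<open>auto simp: raise_above_def\<close>)

lemma raise_above_less_iff: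
  "i \<le> n \<Longrightarrow> j \<le> n \<Longrightarrow> raise_above n v i < raise_above n v j \<longleftrightarrow> i < j"
  by (auto simp: raise_above_def)

text \<open>Take \<open>v\<close> to be the last entry. Undoing \<open>raise_above n v\<close> on
  the values yields a permutation fixing \<open>n + 1\<close>, hence one of
  \<open>{1..n}\<close>.\<close>

lemma permutes_append_cases:
  assumes "\<pi> permutes {1..n + 1}"
  obtains v \<sigma> where "v \<in> {1..n + 1}" "\<sigma> permutes {1..n}" "\<pi> = raise_above n v \<circ> \<sigma>"
proof -
  let ?v = "\<pi> (n + 1)"
  let ?r = "raise_above n ?v"
  have v: "?v \<in> {1..n + 1}" using permutes_in_image[OF assms, of "n + 1"] by simp
  then have r: "?r permutes {1..n + 1}" by (intro raise_above_permutes) auto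
  let ?\<sigma> = "inv ?r \<circ> \<pi>"
  have s: "?\<sigma> permutes {1..n + 1}"
    using permutes_compose[OF assms permutes_inv[OF r]] .
  have "?r (n + 1) = ?v" by (simp add: raise_above_def)
  then have "?\<sigma> (n + 1) = n + 1"
    using permutes_inverses(2)[OF r] by (metis comp_apply)
  moreover have "{1..n + 1} = insert (n + 1) {1..n}" by auto
  ultimately have "?\<sigma> permutes {1..n}"
    using s by (intro permutes_superset[OF s]) auto
  moreover have "\<pi> = ?r \<circ> ?\<sigma>"
    using permutes_inverses(1)[OF r] by (auto simp: fun_eq_iff)
  ultimately show thesis using v that by blast
qed

text \<open>Position 0 is included, being a fixed point, so a position written \<open>n - 1\<close>
  can be treated without a lower bound.\<close>

lemma permutes_le:
  assumes "\<sigma> permutes {1..n}" "i \<le> n"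
  shows "\<sigma> i \<le> n"
  using permutes_in_image[OF assms(1), of i] permutes_not_in[OF assms(1), of i] assms(2)
  by (cases "i \<in> {1..n}") auto

text \<open>The position of the maximum is followed through the prefixes. A descent at
  \<open>j\<close> leaves the maximum at \<open>j\<close>. After an ascent the new entry exceeds the
  old maximum: directly if that sits at \<open>j\<close>, and by the avoidance condition if it sits
  at \<open>j - 1\<close>.\<close>

lemma des_perms_312_peak:
  assumes "\<sigma> \<in> des_perms_312 n D" and D: "\<And>i. i \<in> D \<Longrightarrow> i + 1 \<notin> D" and "0 \<notin> D"
    and "1 \<le> n"
  shows "\<sigma> (if n - 1 \<in> D then n - 1 else n) = n"
proof -
  have \<sigma>: "\<sigma> \<in> des_perms n D" and perm: "\<sigma> permutes {1..n}"
    and avoid: "\<And>i. 1 \<le> i \<Longrightarrow> i + 2 \<le> n \<Longrightarrow> i \<in> D \<Longrightarrow> \<sigma> i < \<sigma> (i + 2)"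
    and des: "\<And>i. 1 \<le> i \<Longrightarrow> i < n \<Longrightarrow> i \<in> D \<Longrightarrow> \<sigma> (i + 1) < \<sigma> i"
    using assms(1) unfolding des_perms_312_def des_perms_def by auto
  have peak: "\<forall>i\<in>{1..j}. \<sigma> i \<le> \<sigma> (if j - 1 \<in> D then j - 1 else j)" if "1 \<le> j" "j \<le> n" for j
    using that
  proof (induction j rule: dec_induct)
    case base
    then show ?case using \<open>0 \<notin> D\<close> by simp
  next
    case (step j)
    then have IH: "\<forall>i\<in>{1..j}. \<sigma> i \<le> \<sigma> (if j - 1 \<in> D then j - 1 else j)" by simp
    have range: "{1..Suc j} = insert (Suc j) {1..j}" by auto
    show ?case
    proof (cases "j \<in> D")
      case True
      then have "j - 1 \<notin> D" using D[of "j - 1"] step by auto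
      then show ?thesis using True IH des[of j] step range by auto
    next
      case False
      then have asc: "\<sigma> j < \<sigma> (Suc j)" using des_perms_ascent[OF \<sigma>, of j] step by simp
      \<comment> \<open>This is the window starting at the descent \<open>j - 1\<close>. Since 0 is
        not in \<open>D\<close>, the subtraction is not truncated.\<close>
      have "\<sigma> (j - 1) < \<sigma> (Suc j)" if "j - 1 \<in> D"
      proof -
        have "j - 1 \<noteq> 0" using that \<open>0 \<notin> D\<close> by metis
        moreover from this have "j - 1 + 2 = Suc j" by simp
        ultimately show ?thesis using avoid[of "j - 1"] that step by simp
      qed
      then have "\<sigma> (if j - 1 \<in> D then j - 1 else j) < \<sigma> (Suc j)" using asc by simp
      then have "\<forall>i\<in>{1..Suc j}. \<sigma> i \<le> \<sigma> (Suc j)" using IH unfolding range by fastforce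
      then show ?thesis using False by simp
    qed
  qed
  \<comment> \<open>The value \<open>n\<close> occurs somewhere, so the largest entry equals
    \<open>n\<close>.\<close>
  have "n \<in> \<sigma> ` {1..n}" using permutes_image[OF perm] \<open>1 \<le> n\<close> by simp
  then have "n \<le> \<sigma> (if n - 1 \<in> D then n - 1 else n)"
    using peak[of n] \<open>1 \<le> n\<close> by auto
  moreover have "\<sigma> (if n - 1 \<in> D then n - 1 else n) \<le> n"
    by (intro permutes_le[OF perm]) simp
  ultimately show ?thesis by simp
qed

text \<open>Appending keeps all comparisons among the old entries. The only new conditions are the
  one on a descent at \<open>n\<close> and the one on the window starting at \<open>n - 1\<close>,
  and the known position of the maximum turns both into a condition on \<open>v\<close>
  alone.\<close>

lemma append_in_des_perms_312_iff:
  assumes D: "\<And>i. i \<in> D \<Longrightarrow> i + 1 \<notin> D" and "0 \<notin> D" and "1 \<le> n"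
    and v: "v \<in> {1..n + 1}" and \<sigma>: "\<sigma> permutes {1..n}"
  shows "raise_above n v \<circ> \<sigma> \<in> des_perms_312 (n + 1) D \<longleftrightarrow>
    \<sigma> \<in> des_perms_312 n D \<and> v \<in> (if n \<in> D then {1..n} else {n + 1})"
proof -
  let ?\<pi> = "raise_above n v \<circ> \<sigma>"
  have perm: "?\<pi> permutes {1..n + 1}"
    using v by (intro permutes_compose[OF permutes_subset[OF \<sigma>] raise_above_permutes]) auto
  have less: "?\<pi> i < ?\<pi> j \<longleftrightarrow> \<sigma> i < \<sigma> j" if "i \<le> n" "j \<le> n" for i j
    using raise_above_less_iff[OF permutes_le[OF \<sigma> that(1)] permutes_le[OF \<sigma> that(2)]] by simp
  have last: "?\<pi> (n + 1) = v"
    using permutes_not_in[OF \<sigma>, of "n + 1"] by (simp add: raise_above_def)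
  \<comment> \<open>An old entry equal to \<open>v\<close> is raised to \<open>v + 1\<close>; hence
    the weak inequality here and the strict one in \<open>less_last\<close>.\<close>
  have last_less: "v < ?\<pi> i \<longleftrightarrow> v \<le> \<sigma> i" if "i \<le> n" for i
    using permutes_le[OF \<sigma> that] by (auto simp: raise_above_def)
  have less_last: "?\<pi> i < v \<longleftrightarrow> \<sigma> i < v" if "i \<le> n" for i
    using permutes_le[OF \<sigma> that] by (auto simp: raise_above_def)
  have ivl: "{1..<n + 1} = insert n {1..<n}" using \<open>1 \<le> n\<close> by auto
  have "?\<pi> \<in> des_perms (n + 1) D \<longleftrightarrow> \<sigma> \<in> des_perms n D \<and> (v \<le> \<sigma> n \<longleftrightarrow> n \<in> D)"
  proof -
    have "(\<forall>i\<in>{1..<n + 1}. ?\<pi> (i + 1) < ?\<pi> i \<longleftrightarrow> i \<in> D) \<longleftrightarrow>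
        (v < ?\<pi> n \<longleftrightarrow> n \<in> D) \<and> (\<forall>i\<in>{1..<n}. ?\<pi> (i + 1) < ?\<pi> i \<longleftrightarrow> i \<in> D)"
      unfolding ivl by (simp only: ball_simps last)
    also have "(\<forall>i\<in>{1..<n}. ?\<pi> (i + 1) < ?\<pi> i \<longleftrightarrow> i \<in> D) \<longleftrightarrow>
        (\<forall>i\<in>{1..<n}. \<sigma> (i + 1) < \<sigma> i \<longleftrightarrow> i \<in> D)"
      by (intro ball_cong refl) (subst less, auto)
    finally show ?thesis
      unfolding des_perms_def using perm \<sigma> last_less[of n] by blast
  qed
  moreover have "(\<forall>i. 1 \<le> i \<and> i + 2 \<le> n + 1 \<and> i \<in> D \<longrightarrow> ?\<pi> i < ?\<pi> (i + 2)) \<longleftrightarrow>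
      (\<forall>i. 1 \<le> i \<and> i + 2 \<le> n \<and> i \<in> D \<longrightarrow> \<sigma> i < \<sigma> (i + 2)) \<and> (n - 1 \<in> D \<longrightarrow> \<sigma> (n - 1) < v)"
    (is "?L \<longleftrightarrow> ?R")
  proof
    assume L: ?L
    have "\<sigma> (n - 1) < v" if "n - 1 \<in> D"
    proof -
      have "n - 1 \<noteq> 0" using that \<open>0 \<notin> D\<close> by metis
      moreover from this have "n - 1 + 2 = n + 1" by simp
      ultimately have "?\<pi> (n - 1) < ?\<pi> (n + 1)" using L that
        by (metis One_nat_def Suc_leI le_refl neq0_conv)
      then show ?thesis using last less_last[of "n - 1"] by simp
    qed
    moreover have "\<sigma> i < \<sigma> (i + 2)" if "1 \<le> i" "i + 2 \<le> n" "i \<in> D" for i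
      using L that less[of i "i + 2"] by simp
    ultimately show ?R by blast
  next
    assume R: ?R
    show ?L
    proof (intro allI impI)
      fix i assume i: "1 \<le> i \<and> i + 2 \<le> n + 1 \<and> i \<in> D"
      show "?\<pi> i < ?\<pi> (i + 2)"
      proof (cases "i + 2 \<le> n")
        case True
        then show ?thesis using R i less[of i "i + 2"] by simp
      next
        case False
        then have "n - 1 = i" "i + 2 = n + 1" using i by auto
        then show ?thesis using R i last less_last[of i] by simp
      qed
    qed
  qed
  ultimately have iff: "?\<pi> \<in> des_perms_312 (n + 1) D \<longleftrightarrow>
      \<sigma> \<in> des_perms_312 n D \<and> (v \<le> \<sigma> n \<longleftrightarrow> n \<in> D) \<and> (n - 1 \<in> D \<longrightarrow> \<sigma> (n - 1) < v)"
    unfolding des_perms_312_def by blast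
  \<comment> \<open>If \<open>n\<close> is a descent, then \<open>n - 1\<close> is not, so \<sigma>
    n is \<open>n\<close> and \<open>v\<close> ranges up to \<open>n\<close>. Otherwise
    \<open>v\<close> must exceed the maximum \<open>n\<close>, found at position \<open>n\<close> or
    \<open>n - 1\<close>.\<close>
  have "(v \<le> \<sigma> n \<longleftrightarrow> n \<in> D) \<and> (n - 1 \<in> D \<longrightarrow> \<sigma> (n - 1) < v) \<longleftrightarrow>
      v \<in> (if n \<in> D then {1..n} else {n + 1})" if "\<sigma> \<in> des_perms_312 n D"
  proof -
    have peak: "\<sigma> (if n - 1 \<in> D then n - 1 else n) = n"
      using des_perms_312_peak[OF that D] assms by blast
    have le: "\<sigma> n \<le> n" using permutes_le[OF \<sigma>] by simp
    have "n \<notin> D" if "n - 1 \<in> D" using D[OF that] \<open>1 \<le> n\<close> by simp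
    then show ?thesis using peak le v by (auto split: if_splits)
  qed
  then show ?thesis using iff by blast
qed

text \<open>The set of admissible last values does not depend on the shorter permutation, so
  appending is a bijection from a full Cartesian product.\<close>

lemma card_des_perms_312_Suc:
  assumes D: "\<And>i. i \<in> D \<Longrightarrow> i + 1 \<notin> D" and "0 \<notin> D" and "1 \<le> n"
  shows "card (des_perms_312 (n + 1) D) = card (des_perms_312 n D) * (if n \<in> D then n else 1)"
proof -
  let ?V = "if n \<in> D then {1..n} else {n + 1}"
  let ?f = "\<lambda>(v, \<sigma>). raise_above n v \<circ> \<sigma>"
  have V: "?V \<subseteq> {1..n + 1}" by auto
  have perm: "\<sigma> permutes {1..j}" if "\<sigma> \<in> des_perms_312 j D" for \<sigma> j
    using that by (simp add: des_perms_312_def des_perms_def)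
  have "des_perms_312 (n + 1) D = ?f ` (?V \<times> des_perms_312 n D)"
  proof (intro equalityI subsetI)
    fix \<pi> assume \<pi>: "\<pi> \<in> des_perms_312 (n + 1) D"
    then obtain v \<sigma> where "v \<in> {1..n + 1}" "\<sigma> permutes {1..n}" "\<pi> = raise_above n v \<circ> \<sigma>"
      using permutes_append_cases[OF perm[OF \<pi>]] by metis
    then show "\<pi> \<in> ?f ` (?V \<times> des_perms_312 n D)"
      using append_in_des_perms_312_iff[OF assms, of v \<sigma>] \<pi> by (auto intro!: image_eqI[of _ _ "(v, \<sigma>)"])
  next
    fix \<pi> assume "\<pi> \<in> ?f ` (?V \<times> des_perms_312 n D)"
    then obtain v \<sigma> where "v \<in> ?V" "\<sigma> \<in> des_perms_312 n D" "\<pi> = raise_above n v \<circ> \<sigma>"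
      by (auto simp del: if_split)
    then show "\<pi> \<in> des_perms_312 (n + 1) D"
      using append_in_des_perms_312_iff[OF assms, of v \<sigma>] V perm by blast
  qed
  moreover have "inj_on ?f (?V \<times> des_perms_312 n D)"
  proof (rule inj_onI, clarify)
    fix v w \<sigma> \<tau>
    assume vw: "v \<in> ?V" "w \<in> ?V" and st: "\<sigma> \<in> des_perms_312 n D" "\<tau> \<in> des_perms_312 n D"
      and eq: "raise_above n v \<circ> \<sigma> = raise_above n w \<circ> \<tau>"
    \<comment> \<open>The appended value is read off at position \<open>n + 1\<close>; the shorter
      permutation is then recovered by injectivity of \<open>raise_above n v\<close>.\<close>
    have "(raise_above n v \<circ> \<sigma>) (n + 1) = v" "(raise_above n w \<circ> \<tau>) (n + 1) = w"
      using permutes_not_in[OF perm, of _ n "n + 1"] st by (simp_all add: raise_above_def)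
    then have "v = w" using eq by simp
    have "inj (raise_above n v)"
    proof (rule permutes_inj[OF raise_above_permutes])
      show "1 \<le> v" "v \<le> n + 1" using subsetD[OF V vw(1)] by simp_all
    qed
    moreover have "raise_above n v (\<sigma> i) = raise_above n v (\<tau> i)" for i
      using fun_cong[OF eq, of i] \<open>v = w\<close> by simp
    ultimately have "\<sigma> i = \<tau> i" for i by (simp add: inj_eq)
    then show "v = w \<and> \<sigma> = \<tau>" using \<open>v = w\<close> by auto
  qed
  ultimately have "card (des_perms_312 (n + 1) D) = card (?V \<times> des_perms_312 n D)"
    by (simp only: card_image)
  then show ?thesis by (simp add: card_cartesian_product)
qed

lemma card_des_perms_312:
  assumes D: "\<And>i. i \<in> D \<Longrightarrow> i + 1 \<notin> D" and "0 \<notin> D" and "1 \<le> n"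
  shows "card (des_perms_312 n D) = \<Prod>(D \<inter> {1..<n})"
  using \<open>1 \<le> n\<close>
proof (induction n rule: dec_induct)
  case base
  have "des_perms_312 1 D = {id}"
    unfolding des_perms_312_def des_perms_def by (auto simp: permutes_sing)
  then show ?case by simp
next
  case (step n)
  have "D \<inter> {1..<Suc n} = (if n \<in> D then insert n (D \<inter> {1..<n}) else D \<inter> {1..<n})"
    using step by (auto simp: less_Suc_eq)
  then have "\<Prod>(D \<inter> {1..<Suc n}) = \<Prod>(D \<inter> {1..<n}) * (if n \<in> D then n else 1)"
    by simp
  then show ?case
    using card_des_perms_312_Suc[OF D \<open>0 \<notin> D\<close>] step by simp
qed

section \<open>Reverse complement\<close>

text \<open>The identity outside \<open>{1..N}\<close> makes this a permutation in the sense of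
  \<open>permutes\<close> and an involution on all naturals.\<close>

definition flip :: "nat \<Rightarrow> nat \<Rightarrow> nat" where
  "flip N i = (if i \<in> {1..N} then N + 1 - i else i)"

lemma flip_flip: "flip N (flip N i) = i"
  by (auto simp: flip_def)

lemma flip_permutes: "flip N permutes {1..N}"
  by (rule bij_imp_permutes)
    (auto simp: flip_def intro!: bij_betw_byWitness[where f' = "flip N"])

definition reverse_complement :: "nat \<Rightarrow> (nat \<Rightarrow> nat) \<Rightarrow> nat \<Rightarrow> nat" where
  "reverse_complement N \<pi> = flip N \<circ> \<pi> \<circ> flip N"

lemma reverse_complement_involution: "reverse_complement N (reverse_complement N \<pi>) = \<pi>"
  by (simp add: reverse_complement_def fun_eq_iff flip_flip)

lemma reverse_complement_permutes:
  "\<pi> permutes {1..N} \<Longrightarrow> reverse_complement N \<pi> permutes {1..N}"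
  unfolding reverse_complement_def
  by (intro permutes_compose flip_permutes)

lemma reverse_complement_less_iff:
  assumes "\<pi> permutes {1..N}" "i \<in> {1..N}" "j \<in> {1..N}"
  shows "reverse_complement N \<pi> i < reverse_complement N \<pi> j \<longleftrightarrow> \<pi> (N + 1 - j) < \<pi> (N + 1 - i)"
proof -
  let ?a = "\<pi> (N + 1 - i)" and ?b = "\<pi> (N + 1 - j)"
  have rev: "N + 1 - i \<in> {1..N}" "N + 1 - j \<in> {1..N}" using assms(2,3) by auto
  then have range: "?a \<in> {1..N}" "?b \<in> {1..N}"
    using permutes_in_image[OF assms(1)] by blast+
  have "reverse_complement N \<pi> i = N + 1 - ?a" "reverse_complement N \<pi> j = N + 1 - ?b"
    using assms(2,3) range by (simp_all add: reverse_complement_def flip_def)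
  moreover have "?a \<le> N" "?b \<le> N" using range by simp_all
  ultimately show ?thesis by linarith
qed

text \<open>Positions and values are both reversed, so a descent at \<open>i\<close> becomes one at
  \<open>N - i\<close>. The window starting at \<open>i\<close> becomes the one starting at
  \<open>N - 1 - i\<close>, and its middle position \<open>i + 1\<close> becomes the first position
  there: the 231 condition turns into the 312 condition.\<close>

lemma reverse_complement_in_des_perms_231_iff:
  assumes \<pi>: "\<pi> permutes {1..N}"
  shows "reverse_complement N \<pi> \<in> des_perms_231 N D \<longleftrightarrow>
    \<pi> \<in> des_perms_312 N ((\<lambda>d. N - d) ` (D \<inter> {1..<N}))"
proof -
  let ?\<rho> = "reverse_complement N \<pi>"
  \<comment> \<open>Cutting \<open>D\<close> down to \<open>{1..<N}\<close> keeps
    \<open>N - d\<close> free of truncation and within the same range.\<close>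
  let ?D = "(\<lambda>d. N - d) ` (D \<inter> {1..<N})"
  have mem: "N - i \<in> ?D \<longleftrightarrow> i \<in> D" if "1 \<le> i" "i < N" for i
  proof
    assume "N - i \<in> ?D"
    then obtain d where "d \<in> D" "d < N" "N - i = N - d" by auto
    moreover from this that have "d = i" by linarith
    ultimately show "i \<in> D" by simp
  qed (use that in auto)
  have less: "?\<rho> i < ?\<rho> j \<longleftrightarrow> \<pi> (N + 1 - j) < \<pi> (N + 1 - i)"
    if "1 \<le> i" "i \<le> N" "1 \<le> j" "j \<le> N" for i j
    using reverse_complement_less_iff[OF \<pi>] that by simp
  \<comment> \<open>Reversal of an interval, applied with \<open>n = N - 1\<close> to descents and
    with \<open>n = N - 2\<close> to windows. The indices below stay unsimplified in order to match
    it.\<close>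
  have reindex: "(\<forall>i. 1 \<le> i \<and> i \<le> n \<longrightarrow> P i) \<longleftrightarrow> (\<forall>i. 1 \<le> i \<and> i \<le> n \<longrightarrow> P (n + 1 - i))"
    for n :: nat and P
  proof -
    have "1 \<le> n + 1 - i \<and> n + 1 - i \<le> n \<and> n + 1 - (n + 1 - i) = i" if "1 \<le> i \<and> i \<le> n" for i
      using that by auto
    then show ?thesis by metis
  qed
  have "(\<forall>i\<in>{1..<N}. ?\<rho> (i + 1) < ?\<rho> i \<longleftrightarrow> i \<in> D) \<longleftrightarrow>
      (\<forall>i. 1 \<le> i \<and> i \<le> N - 1 \<longrightarrow> (?\<rho> (i + 1) < ?\<rho> i \<longleftrightarrow> i \<in> D))"
    by auto
  also have "\<dots> \<longleftrightarrow> (\<forall>i. 1 \<le> i \<and> i \<le> N - 1 \<longrightarrow>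
      (\<pi> (N - 1 + 1 - i + 1) < \<pi> (N - 1 + 1 - i) \<longleftrightarrow> N - 1 + 1 - i \<in> ?D))"
  proof (intro all_cong)
    fix i assume i: "1 \<le> i \<and> i \<le> N - 1"
    then have eq: "N - 1 + 1 - i = N - i" "N - i + 1 = N + 1 - i" by auto
    have "1 \<le> i" "i < N" using i by auto
    then show "(?\<rho> (i + 1) < ?\<rho> i \<longleftrightarrow> i \<in> D) \<longleftrightarrow>
      (\<pi> (N - 1 + 1 - i + 1) < \<pi> (N - 1 + 1 - i) \<longleftrightarrow> N - 1 + 1 - i \<in> ?D)"
      unfolding eq using less[of "i + 1" i] mem[of i] by simp
  qed
  also have "\<dots> \<longleftrightarrow> (\<forall>i. 1 \<le> i \<and> i \<le> N - 1 \<longrightarrow> (\<pi> (i + 1) < \<pi> i \<longleftrightarrow> i \<in> ?D))"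
    using reindex[of "N - 1" "\<lambda>i. \<pi> (i + 1) < \<pi> i \<longleftrightarrow> i \<in> ?D"] by (rule sym)
  also have "\<dots> \<longleftrightarrow> (\<forall>i\<in>{1..<N}. \<pi> (i + 1) < \<pi> i \<longleftrightarrow> i \<in> ?D)"
    by auto
  finally have des: "(\<forall>i\<in>{1..<N}. ?\<rho> (i + 1) < ?\<rho> i \<longleftrightarrow> i \<in> D) \<longleftrightarrow>
    (\<forall>i\<in>{1..<N}. \<pi> (i + 1) < \<pi> i \<longleftrightarrow> i \<in> ?D)" .
  have "(\<forall>i. 1 \<le> i \<and> i + 2 \<le> N \<and> i + 1 \<in> D \<longrightarrow> ?\<rho> i < ?\<rho> (i + 2)) \<longleftrightarrow>
      (\<forall>i. 1 \<le> i \<and> i \<le> N - 2 \<longrightarrow> i + 1 \<in> D \<longrightarrow> ?\<rho> i < ?\<rho> (i + 2))"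
    by auto
  also have "\<dots> \<longleftrightarrow> (\<forall>i. 1 \<le> i \<and> i \<le> N - 2 \<longrightarrow> N - 2 + 1 - i \<in> ?D \<longrightarrow>
      \<pi> (N - 2 + 1 - i) < \<pi> (N - 2 + 1 - i + 2))"
  proof (intro all_cong)
    fix i assume i: "1 \<le> i \<and> i \<le> N - 2"
    then have eq: "N - 2 + 1 - i = N - (i + 1)" "N - (i + 1) + 2 = N + 1 - i" by auto
    have "i + 2 \<le> N" using i by auto
    then show "(i + 1 \<in> D \<longrightarrow> ?\<rho> i < ?\<rho> (i + 2)) \<longleftrightarrow>
      (N - 2 + 1 - i \<in> ?D \<longrightarrow> \<pi> (N - 2 + 1 - i) < \<pi> (N - 2 + 1 - i + 2))"
      unfolding eq using less[of i "i + 2"] mem[of "i + 1"] i by simp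
  qed
  also have "\<dots> \<longleftrightarrow> (\<forall>i. 1 \<le> i \<and> i \<le> N - 2 \<longrightarrow> i \<in> ?D \<longrightarrow> \<pi> i < \<pi> (i + 2))"
    using reindex[of "N - 2" "\<lambda>i. i \<in> ?D \<longrightarrow> \<pi> i < \<pi> (i + 2)"] by (rule sym)
  also have "\<dots> \<longleftrightarrow> (\<forall>i. 1 \<le> i \<and> i + 2 \<le> N \<and> i \<in> ?D \<longrightarrow> \<pi> i < \<pi> (i + 2))"
    by auto
  finally show ?thesis
    using des \<pi> reverse_complement_permutes[OF \<pi>]
    unfolding des_perms_231_def des_perms_312_def des_perms_def by blast
qed

text \<open>The reflected descent set again has no adjacent elements and does not contain 0, so the
  count for 312 applies to it.\<close>

lemma card_des_perms_231:
  assumes D: "\<And>i. i \<in> D \<Longrightarrow> i + 1 \<notin> D" and "1 \<le> N"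
  shows "card (des_perms_231 N D) = (\<Prod>d\<in>D \<inter> {1..<N}. N - d)"
proof -
  let ?D = "(\<lambda>d. N - d) ` (D \<inter> {1..<N})"
  have perm: "\<pi> permutes {1..N}" if "\<pi> \<in> des_perms_231 N D \<or> \<pi> \<in> des_perms_312 N ?D" for \<pi>
    using that by (auto simp: des_perms_231_def des_perms_312_def des_perms_def)
  have "bij_betw (reverse_complement N) (des_perms_231 N D) (des_perms_312 N ?D)"
  proof (rule bij_betw_byWitness[where f' = "reverse_complement N"])
    show "reverse_complement N ` des_perms_312 N ?D \<subseteq> des_perms_231 N D"
      using reverse_complement_in_des_perms_231_iff perm by blast
    show "reverse_complement N ` des_perms_231 N D \<subseteq> des_perms_312 N ?D"
    proof
      fix \<pi> assume "\<pi> \<in> reverse_complement N ` des_perms_231 N D"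
      then obtain \<sigma> where \<sigma>: "\<sigma> \<in> des_perms_231 N D" "\<pi> = reverse_complement N \<sigma>" by blast
      then show "\<pi> \<in> des_perms_312 N ?D"
        using reverse_complement_in_des_perms_231_iff[of \<pi> N D] reverse_complement_permutes perm
        by (simp add: reverse_complement_involution)
    qed
  qed (simp_all add: reverse_complement_involution)
  then have "card (des_perms_231 N D) = card (des_perms_312 N ?D)"
    by (rule bij_betw_same_card)
  also have "\<dots> = \<Prod>(?D \<inter> {1..<N})"
  proof (rule card_des_perms_312)
    fix i assume "i \<in> ?D"
    then obtain d where d: "d \<in> D" "1 \<le> d" "d < N" "i = N - d" by auto
    show "i + 1 \<notin> ?D"
    proof
      assume "i + 1 \<in> ?D"
      then obtain e where "e \<in> D" "1 \<le> e" "e < N" "i + 1 = N - e" by auto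
      moreover from this d have "d = e + 1" by linarith
      ultimately show False using d D[of e] by simp
    qed
  qed (use \<open>1 \<le> N\<close> in auto)
  also have "?D \<inter> {1..<N} = ?D" by auto
  also have "\<Prod>?D = (\<Prod>d\<in>D \<inter> {1..<N}. N - d)"
    by (subst prod.reindex) (auto simp: inj_on_def)
  finally show ?thesis .
qed

section \<open>Linear extensions as permutations\<close>

text \<open>A linear order is reflexive and transitive, so it contains the closures as soon as it
  contains the generators.\<close>

lemma linear_extensions_add_relations:
  "linear_extensions A (add_relations (generated_order A g) q) =
    {l. linear_order_on A l \<and> g \<union> q \<subseteq> l}"
proof -
  have "add_relations (generated_order A g) q \<subseteq> l \<longleftrightarrow> g \<union> q \<subseteq> l" if "linear_order_on A l" for l
  proof
    assume "add_relations (generated_order A g) q \<subseteq> l"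
    moreover have "g \<union> q \<subseteq> add_relations (generated_order A g) q"
      unfolding add_relations_def generated_order_def by auto
    ultimately show "g \<union> q \<subseteq> l" by blast
  next
    assume gq: "g \<union> q \<subseteq> l"
    have l: "refl_on A l" "trans l"
      using that by (auto simp: linear_order_on_def partial_order_on_def preorder_on_def)
    then have "l\<^sup>+ = l" by (simp add: trancl_id)
    moreover have "Id_on A \<subseteq> l" using l(1) by (auto simp: refl_on_def)
    moreover have "g\<^sup>+ \<subseteq> l\<^sup>+" using gq by (intro trancl_mono_subset) auto
    ultimately have "generated_order A g \<union> q \<subseteq> l"
      using gq unfolding generated_order_def by auto
    then show "add_relations (generated_order A g) q \<subseteq> l"
      unfolding add_relations_def using \<open>l\<^sup>+ = l\<close> by (metis trancl_mono_subset)
  qed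
  then show ?thesis unfolding linear_extensions_def by blast
qed

text \<open>A linear order on \<open>N\<close> elements is the same as a ranking by
  \<open>{1..N}\<close>; reading the ranks at the positions \<open>pos x\<close> gives the
  permutation. The inequalities are weak because the orders are reflexive.\<close>

lemma card_linear_orders_containing:
  fixes pos :: "'a \<Rightarrow> nat"
  assumes pos: "bij_betw pos A {1..N}" and g: "g \<subseteq> A \<times> A"
  shows "card {l. linear_order_on A l \<and> g \<subseteq> l} =
    card {\<pi>. \<pi> permutes {1..N} \<and> (\<forall>(x, y)\<in>g. \<pi> (pos x) \<le> \<pi> (pos y))}"
proof -
  let ?P = "{\<pi>. \<pi> permutes {1..N} \<and> (\<forall>(x, y)\<in>g. \<pi> (pos x) \<le> \<pi> (pos y))}"
  let ?L = "{l. linear_order_on A l \<and> g \<subseteq> l}"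
  define ord where "ord \<pi> = {(x, y). x \<in> A \<and> y \<in> A \<and> \<pi> (pos x) \<le> \<pi> (pos y)}" for \<pi> :: "nat \<Rightarrow> nat"
  have finA: "finite A" and cardA: "card A = N"
    using bij_betw_finite[OF pos] bij_betw_same_card[OF pos] by auto
  have bij: "bij_betw (\<lambda>x. \<pi> (pos x)) A {1..N}" if "\<pi> permutes {1..N}" for \<pi>
    using bij_betw_trans[OF pos permutes_imp_bij[OF that]] by (simp add: comp_def)
  have inj: "inj_on ord ?P"
  proof (rule inj_onI)
    fix \<pi> \<sigma> assume \<pi>: "\<pi> \<in> ?P" and \<sigma>: "\<sigma> \<in> ?P" and eq: "ord \<pi> = ord \<sigma>"
    \<comment> \<open>The order determines the permutation: each value is the number of elements at
      or below the given one.\<close>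
    have rank: "\<tau> (pos x) = card {y. (y, x) \<in> ord \<tau>}" if \<tau>: "\<tau> \<in> ?P" and "x \<in> A" for \<tau> x
    proof -
      have b: "bij_betw (\<lambda>x. \<tau> (pos x)) A {1..N}" using bij \<tau> by simp
      then have range: "\<tau> (pos y) \<in> {1..N}" if "y \<in> A" for y
        using that by (auto simp: bij_betw_def)
      have "(\<lambda>y. \<tau> (pos y)) ` {y. (y, x) \<in> ord \<tau>} = {1..\<tau> (pos x)}"
      proof (intro equalityI subsetI)
        fix v assume v: "v \<in> {1..\<tau> (pos x)}"
        then have "v \<in> {1..N}" using range[OF \<open>x \<in> A\<close>] by auto
        then obtain y where "y \<in> A" "v = \<tau> (pos y)" using b unfolding bij_betw_def by blast
        then show "v \<in> (\<lambda>y. \<tau> (pos y)) ` {y. (y, x) \<in> ord \<tau>}"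
          using v \<open>x \<in> A\<close> by (auto simp: ord_def)
      qed (use range in \<open>auto simp: ord_def\<close>)
      moreover have "inj_on (\<lambda>y. \<tau> (pos y)) {y. (y, x) \<in> ord \<tau>}"
        using b by (auto simp: bij_betw_def ord_def intro: inj_on_subset)
      ultimately show ?thesis by (metis card_image card_atLeastAtMost diff_Suc_1)
    qed
    show "\<pi> = \<sigma>"
    proof
      fix i
      show "\<pi> i = \<sigma> i"
      proof (cases "i \<in> {1..N}")
        case True
        then obtain x where "x \<in> A" "i = pos x" using pos unfolding bij_betw_def by blast
        then show ?thesis using rank[OF \<pi>] rank[OF \<sigma>] eq by simp
      next
        case False
        then show ?thesis using \<pi> \<sigma> by (simp add: permutes_def)
      qed
    qed
  qed
  have "ord ` ?P = ?L"
  proof (intro equalityI subsetI)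
    fix l assume "l \<in> ord ` ?P"
    then obtain \<pi> where l: "l = ord \<pi>" and \<pi>: "\<pi> \<in> ?P" by blast
    have "inj_on (\<lambda>x. \<pi> (pos x)) A" using bij \<pi> by (simp add: bij_betw_def)
    then have "linear_order_on A l"
      unfolding l ord_def linear_order_on_def partial_order_on_def preorder_on_def
      by (auto simp: refl_on_def trans_def antisym_def total_on_def inj_on_def)
    moreover have "g \<subseteq> l" using \<pi> g unfolding l ord_def by auto
    ultimately show "l \<in> ?L" by simp
  next
    fix l assume "l \<in> ?L"
    then have lin: "linear_order_on A l" and gl: "g \<subseteq> l" by auto
    then have l: "l \<subseteq> A \<times> A" "refl_on A l" "trans l" "antisym l" "total_on A l"
      by (auto simp: linear_order_on_def partial_order_on_def preorder_on_def)
    \<comment> \<open>Each element counts itself, so ranks start at 1.\<close>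
    define rank where "rank x = card {y. (y, x) \<in> l}" for x
    have fin: "finite {y. (y, x) \<in> l}" for x
      by (rule finite_subset[OF _ finA]) (use l(1) in auto)
    \<comment> \<open>The down-set of \<open>x\<close> lies in that of \<open>y\<close> by
      transitivity, and \<open>y\<close> belongs only to the latter by antisymmetry.\<close>
    have rank_less: "rank x < rank y" if "(x, y) \<in> l" "x \<noteq> y" for x y
      unfolding rank_def
    proof (rule psubset_card_mono[OF fin])
      have "y \<in> A" using that l(1) by auto
      then have "(y, y) \<in> l" using l(2) by (simp add: refl_on_def)
      moreover have "(y, x) \<notin> l" using that l(4) by (auto simp: antisym_def)
      ultimately show "{z. (z, x) \<in> l} \<subset> {z. (z, y) \<in> l}"
        using transD[OF l(3) _ that(1)] by auto
    qed
    have rank_iff: "rank x \<le> rank y \<longleftrightarrow> (x, y) \<in> l" if "x \<in> A" "y \<in> A" for x y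
      using rank_less[of x y] rank_less[of y x] l(2,5) that
      by (cases "x = y") (fastforce simp: refl_on_def total_on_def)+
    have "inj_on rank A"
      using rank_iff l(4) by (metis antisymD inj_onI order_refl)
    moreover have "rank ` A \<subseteq> {1..N}"
    proof
      fix n assume "n \<in> rank ` A"
      then obtain x where x: "x \<in> A" "n = rank x" by blast
      have "(x, x) \<in> l" using x l(2) by (simp add: refl_on_def)
      then have "rank x > 0" using fin by (auto simp: rank_def card_gt_0_iff)
      moreover have "rank x \<le> N"
        unfolding rank_def cardA[symmetric] by (rule card_mono[OF finA]) (use l(1) in auto)
      ultimately show "n \<in> {1..N}" using x by simp
    qed
    ultimately have rank_bij: "bij_betw rank A {1..N}"
      using card_image[of rank A] cardA by (simp add: bij_betw_def card_subset_eq)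
    \<comment> \<open>The ranks are carried over to positions, with the identity outside
      \<open>{1..N}\<close> as \<open>permutes\<close> demands.\<close>
    define \<pi> where "\<pi> i = (if i \<in> {1..N} then rank (inv_into A pos i) else i)" for i
    have \<pi>_pos: "\<pi> (pos x) = rank x" if "x \<in> A" for x
      using that pos by (auto simp: \<pi>_def bij_betw_def)
    have "bij_betw \<pi> {1..N} {1..N} \<longleftrightarrow> bij_betw (rank \<circ> inv_into A pos) {1..N} {1..N}"
      by (rule bij_betw_cong) (simp add: \<pi>_def)
    then have "bij_betw \<pi> {1..N} {1..N}"
      using bij_betw_trans[OF bij_betw_inv_into[OF pos] rank_bij] by simp
    then have "\<pi> permutes {1..N}"
      by (rule bij_imp_permutes) (unfold \<pi>_def, rule if_not_P)
    moreover have "ord \<pi> = l"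
      using l(1) rank_iff by (auto simp: ord_def \<pi>_pos)
    moreover have "\<forall>(x, y)\<in>g. \<pi> (pos x) \<le> \<pi> (pos y)"
      using gl \<open>ord \<pi> = l\<close> by (auto simp: ord_def)
    ultimately show "l \<in> ord ` ?P" by blast
  qed
  then have "bij_betw ord ?P ?L" using inj by (simp add: bij_betw_def)
  then show ?thesis by (simp add: bij_betw_same_card)
qed

section \<open>The block poset\<close>

text \<open>All blocks before the \<open>i\<close>-th have full length \<open>k\<close>, also when
  that block is the last one, so \<open>s\<close> does not enter.\<close>

definition block_pos :: "nat \<Rightarrow> nat \<times> nat \<Rightarrow> nat" where
  "block_pos k = (\<lambda>(i, a). (i - 1) * k + a)"

text \<open>The generators of \<open>block_poset\<close> before closure, since linear extensions can
  be tested on generators.\<close>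

definition block_gens :: "nat \<Rightarrow> nat \<Rightarrow> nat \<Rightarrow> (nat \<times> nat) rel" where
  "block_gens m s k =
    {((i, a), (i, a + 1)) | i a. (i, a) \<in> block_elems m s k \<and> (i, a + 1) \<in> block_elems m s k}
     \<union> {((i + 1, 1), (i, k)) | i. 1 \<le> i \<and> i \<le> m}"

context
  fixes m s k N :: nat
  assumes k: "k \<ge> 2" and s: "1 \<le> s" "s \<le> k" and N: "N = m * k + s"
begin

text \<open>The inverse is division with remainder of \<open>p - 1\<close> by \<open>k\<close>; the
  shifts by one occur because blocks, places and positions all start at 1.\<close>

lemma block_pos_bij: "bij_betw (block_pos k) (block_elems m s k) {1..N}"
proof (rule bij_betw_byWitness[where f' = "\<lambda>p. ((p - 1) div k + 1, (p - 1) mod k + 1)"])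
  have elem: "\<exists>i b. x = (Suc i, Suc b) \<and> b < k \<and> i \<le> m \<and> (i = m \<longrightarrow> b < s)"
    if "x \<in> block_elems m s k" for x
  proof -
    obtain i a where "x = (i, a)" by (cases x)
    then show ?thesis using that s
      by (intro exI[of _ "i - 1"] exI[of _ "a - 1"]) (auto simp: block_elems_def split: if_splits)
  qed
  show "\<forall>x\<in>block_elems m s k.
      ((block_pos k x - 1) div k + 1, (block_pos k x - 1) mod k + 1) = x"
  proof
    fix x assume "x \<in> block_elems m s k"
    then obtain i b where "x = (Suc i, Suc b)" "b < k" using elem by blast
    then show "((block_pos k x - 1) div k + 1, (block_pos k x - 1) mod k + 1) = x"
      by (simp add: block_pos_def)
  qed
  show "\<forall>p\<in>{1..N}. block_pos k ((p - 1) div k + 1, (p - 1) mod k + 1) = p"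
    by (auto simp: block_pos_def)
  show "block_pos k ` block_elems m s k \<subseteq> {1..N}"
  proof (intro image_subsetI)
    fix x assume "x \<in> block_elems m s k"
    then obtain i b where x: "x = (Suc i, Suc b)" "b < k" "i \<le> m" "i = m \<longrightarrow> b < s"
      using elem by blast
    have "i * k + Suc b \<le> N"
    proof (cases "i = m")
      case True
      then show ?thesis using x N by simp
    next
      case False
      then have "Suc i * k \<le> m * k" using x by (intro mult_le_mono1) simp
      then show ?thesis using x N by simp
    qed
    then show "block_pos k x \<in> {1..N}" using x by (simp add: block_pos_def)
  qed
  show "(\<lambda>p. ((p - 1) div k + 1, (p - 1) mod k + 1)) ` {1..N} \<subseteq> block_elems m s k"
  proof (intro image_subsetI)
    fix p assume p: "p \<in> {1..N}"
    let ?i = "(p - 1) div k" and ?b = "(p - 1) mod k"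
    have eq: "?i * k + ?b = p - 1" by simp
    have "p - 1 < m * k + s" using p N by auto
    moreover have "Suc m * k = k + m * k" by simp
    ultimately have "?i * k < Suc m * k" using eq s by linarith
    then have "?i \<le> m" by (metis less_Suc_eq_le mult_less_cancel2)
    moreover have "?b < s" if "?i = m" using eq \<open>p - 1 < m * k + s\<close> that
      by (metis nat_add_left_cancel_less)
    moreover have "?b < k" using k by simp
    ultimately show "(?i + 1, ?b + 1) \<in> block_elems m s k"
      by (auto simp: block_elems_def Suc_le_eq)
  qed
qed

lemma block_gens_subset: "block_gens m s k \<subseteq> block_elems m s k \<times> block_elems m s k"
  using k s by (auto simp: block_gens_def block_elems_def)

text \<open>Here \<open>N - 1\<close> is \<open>m * k + (s - 1)\<close> with remainder
  \<open>s - 1\<close> below \<open>k\<close>, so the quotient is \<open>m\<close>.\<close>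

lemma multiples_below: "{i. k dvd i} \<inter> {1..<N} = (\<lambda>j. k * j) ` {1..m}"
proof -
  have "(N - 1) div k = m"
    using k s N by (intro div_nat_eqI) (auto simp: mult.commute)
  then show ?thesis
    using multiples_eq_image[of k N] k by simp
qed

lemma dvd_less_iff: "1 \<le> p \<and> p < N \<and> k dvd p \<longleftrightarrow> (\<exists>i. 1 \<le> i \<and> i \<le> m \<and> p = i * k)"
proof -
  have "p \<in> {i. k dvd i} \<inter> {1..<N} \<longleftrightarrow> p \<in> (\<lambda>j. k * j) ` {1..m}"
    by (simp only: multiples_below)
  then show ?thesis by (auto simp: mult.commute)
qed

text \<open>The multiples of \<open>k\<close> below \<open>N\<close> are the ends of the first
  \<open>m\<close> blocks. Ascents elsewhere are the chains inside the blocks, and the descents are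
  the relations between a block end and the next block start.\<close>

lemma des_perms_iff_block_gens:
  assumes \<pi>: "\<pi> permutes {1..N}"
  shows "\<pi> \<in> des_perms N {i. k dvd i} \<longleftrightarrow>
    (\<forall>(x, y)\<in>block_gens m s k. \<pi> (block_pos k x) \<le> \<pi> (block_pos k y))"
proof -
  have le_iff: "\<pi> i \<le> \<pi> j \<longleftrightarrow> \<pi> i < \<pi> j" if "i \<noteq> j" for i j
    using permutes_neq[OF \<pi> that] by auto
  have "\<pi> \<in> des_perms N {i. k dvd i} \<longleftrightarrow>
      (\<forall>p. 1 \<le> p \<and> p < N \<and> \<not> k dvd p \<longrightarrow> \<pi> p \<le> \<pi> (p + 1)) \<and>
      (\<forall>p. 1 \<le> p \<and> p < N \<and> k dvd p \<longrightarrow> \<pi> (p + 1) \<le> \<pi> p)"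
    using \<pi> le_iff[of "_ + 1" "_"] unfolding des_perms_def by (auto simp: not_less)
  also have "(\<forall>p. 1 \<le> p \<and> p < N \<and> k dvd p \<longrightarrow> \<pi> (p + 1) \<le> \<pi> p) \<longleftrightarrow>
      (\<forall>i. 1 \<le> i \<and> i \<le> m \<longrightarrow> \<pi> (i * k + 1) \<le> \<pi> (i * k))"
    unfolding dvd_less_iff by blast
  also have "\<dots> \<longleftrightarrow> (\<forall>i. 1 \<le> i \<and> i \<le> m \<longrightarrow>
      \<pi> (block_pos k (i + 1, 1)) \<le> \<pi> (block_pos k (i, k)))"
  proof (intro all_cong)
    fix i assume "1 \<le> i \<and> i \<le> m"
    then have "block_pos k (i, k) = i * k" "block_pos k (i + 1, 1) = i * k + 1"
      by (cases i; simp add: block_pos_def)+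
    then show "\<pi> (i * k + 1) \<le> \<pi> (i * k) \<longleftrightarrow>
      \<pi> (block_pos k (i + 1, 1)) \<le> \<pi> (block_pos k (i, k))" by simp
  qed
  also have "(\<forall>p. 1 \<le> p \<and> p < N \<and> \<not> k dvd p \<longrightarrow> \<pi> p \<le> \<pi> (p + 1)) \<longleftrightarrow>
      (\<forall>i a. (i, a) \<in> block_elems m s k \<and> (i, a + 1) \<in> block_elems m s k \<longrightarrow>
        \<pi> (block_pos k (i, a)) \<le> \<pi> (block_pos k (i, a + 1)))" (is "?L \<longleftrightarrow> ?R")
  proof
    assume L: ?L
    show ?R
    proof (intro allI impI)
      fix i a assume ia: "(i, a) \<in> block_elems m s k \<and> (i, a + 1) \<in> block_elems m s k"
      let ?p = "block_pos k (i, a)"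
      have succ: "block_pos k (i, a + 1) = ?p + 1" by (simp add: block_pos_def)
      have "?p \<in> {1..N}" "?p + 1 \<in> {1..N}"
        using block_pos_bij ia unfolding succ[symmetric] bij_betw_def by blast+
      moreover have "0 < a" "a < k" using ia s by (auto simp: block_elems_def split: if_splits)
      then have "\<not> k dvd ?p"
        using dvd_add_right_iff[of k "(i - 1) * k" a] by (auto simp: block_pos_def dest: dvd_imp_le)
      ultimately show "\<pi> ?p \<le> \<pi> (block_pos k (i, a + 1))" using L succ by simp
    qed
  next
    assume R: ?R
    show ?L
    proof (intro allI impI)
      fix p assume p: "1 \<le> p \<and> p < N \<and> \<not> k dvd p"
      then obtain i a where ia: "(i, a) \<in> block_elems m s k" "p = block_pos k (i, a)"
        using block_pos_bij unfolding bij_betw_def by (metis (no_types) atLeastAtMost_iff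
            image_iff less_imp_le surj_pair)
      have succ: "block_pos k (i, a + 1) = p + 1" using ia by (simp add: block_pos_def)
      \<comment> \<open>\<open>p\<close> is not a multiple of \<open>k\<close>, so it does not end a
        full block, and \<open>p < N\<close>, so it does not end the last one; hence the next place
        exists in the same block.\<close>
      have "a \<noteq> k" using p ia(2) by (auto simp: block_pos_def)
      moreover have "a \<noteq> s" if "i = m + 1"
        using p ia(2) N that by (auto simp: block_pos_def)
      ultimately have "(i, a + 1) \<in> block_elems m s k"
        using ia(1) by (auto simp: block_elems_def split: if_splits)
      then show "\<pi> p \<le> \<pi> (p + 1)" using R ia succ by metis
    qed
  qed
  finally show ?thesis
    unfolding block_gens_def by fast
qed

text \<open>Avoidance of 132 and of 213 only adds comparisons between pairs of block elements, so
  both counts are instances of this one.\<close>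

lemma card_restricted_des_perms:
  assumes q: "q \<subseteq> block_elems m s k \<times> block_elems m s k"
    and Q: "\<And>\<pi>. \<pi> permutes {1..N} \<Longrightarrow>
      Q \<pi> \<longleftrightarrow> (\<forall>(x, y)\<in>q. \<pi> (block_pos k x) \<le> \<pi> (block_pos k y))"
  shows "card {\<pi> \<in> des_perms N {i. k dvd i}. Q \<pi>} =
    LE (block_elems m s k) (add_relations (block_poset m s k) q)"
proof -
  have "\<pi> \<in> des_perms N {i. k dvd i} \<and> Q \<pi> \<longleftrightarrow> \<pi> permutes {1..N} \<and>
      (\<forall>(x, y)\<in>block_gens m s k \<union> q. \<pi> (block_pos k x) \<le> \<pi> (block_pos k y))" for \<pi>
    using des_perms_iff_block_gens[of \<pi>] Q[of \<pi>] by (auto simp: des_perms_def)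
  then have "card {\<pi> \<in> des_perms N {i. k dvd i}. Q \<pi>} =
      card {l. linear_order_on (block_elems m s k) l \<and> block_gens m s k \<union> q \<subseteq> l}"
    using card_linear_orders_containing[OF block_pos_bij, of "block_gens m s k \<union> q"]
      block_gens_subset q by simp
  then show ?thesis
    unfolding LE_def block_poset_def block_gens_def[symmetric] linear_extensions_add_relations .
qed

section \<open>Linear extensions for 132 and 213\<close>

lemma card_avoiding_132:
  "card (desc_perms_avoiding N k [1, 3, 2]) = LE (block_elems m s k) (poset132 m s k)"
  unfolding avoiding_132[OF k] poset132_def
proof (rule card_restricted_des_perms)
  show "{((i + 1, 1), (i, k - 1)) | i. 1 \<le> i \<and> i \<le> m \<and> (i, k - 1) \<in> block_elems m s k}
      \<subseteq> block_elems m s k \<times> block_elems m s k"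
    using s k by (auto simp: block_elems_def)
next
  fix \<pi> assume \<pi>: "\<pi> permutes {1..N}"
  \<comment> \<open>A window with its peak at \<open>i * k\<close> starts at
    \<open>i * k - 1\<close>. Every \<open>i\<close> from 1 to \<open>m\<close> gives one, because
    \<open>i * k\<close> is at least 2 and less than \<open>N\<close>.\<close>
  have "(\<forall>p. 1 \<le> p \<and> p + 2 \<le> N \<and> k dvd p + 1 \<longrightarrow> \<pi> (p + 2) < \<pi> p) \<longleftrightarrow>
      (\<forall>i. 1 \<le> i \<and> i \<le> m \<longrightarrow> \<pi> (i * k + 1) \<le> \<pi> (i * k - 1))"
  proof (intro iffI allI impI)
    fix i assume H: "\<forall>p. 1 \<le> p \<and> p + 2 \<le> N \<and> k dvd p + 1 \<longrightarrow> \<pi> (p + 2) < \<pi> p"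
      and i: "1 \<le> i \<and> i \<le> m"
    have "i * k < N" using dvd_less_iff[of "i * k"] i by blast
    moreover have "2 \<le> i * k" using i k mult_le_mono[of 1 i 2 k] by simp
    moreover from this have "i * k - 1 + 2 = i * k + 1" "i * k - 1 + 1 = i * k" by simp_all
    ultimately show "\<pi> (i * k + 1) \<le> \<pi> (i * k - 1)"
      using H[rule_format, of "i * k - 1"] by simp
  next
    fix p assume H: "\<forall>i. 1 \<le> i \<and> i \<le> m \<longrightarrow> \<pi> (i * k + 1) \<le> \<pi> (i * k - 1)"
      and p: "1 \<le> p \<and> p + 2 \<le> N \<and> k dvd p + 1"
    then obtain i where "1 \<le> i" "i \<le> m" "p + 1 = i * k" using dvd_less_iff[of "p + 1"] by auto
    moreover from this have "i * k + 1 = p + 2" "i * k - 1 = p" by simp_all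
    ultimately show "\<pi> (p + 2) < \<pi> p"
      using H permutes_neq[OF \<pi>, of "p + 2" p] by (metis le_neq_implies_less add_eq_self_zero
          zero_neq_numeral)
  qed
  also have "\<dots> \<longleftrightarrow> (\<forall>i. 1 \<le> i \<and> i \<le> m \<longrightarrow>
      \<pi> (block_pos k (i + 1, 1)) \<le> \<pi> (block_pos k (i, k - 1)))"
  proof (intro all_cong)
    fix i assume "1 \<le> i \<and> i \<le> m"
    then have "block_pos k (i, k - 1) = i * k - 1" "block_pos k (i + 1, 1) = i * k + 1"
      using k by (cases i; simp add: block_pos_def)+
    then show "\<pi> (i * k + 1) \<le> \<pi> (i * k - 1) \<longleftrightarrow>
      \<pi> (block_pos k (i + 1, 1)) \<le> \<pi> (block_pos k (i, k - 1))" by simp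
  qed
  also have "\<dots> \<longleftrightarrow> (\<forall>(x, y)\<in>{((i + 1, 1), (i, k - 1)) | i.
      1 \<le> i \<and> i \<le> m \<and> (i, k - 1) \<in> block_elems m s k}. \<pi> (block_pos k x) \<le> \<pi> (block_pos k y))"
    \<comment> \<open>Since \<open>k\<close> is at least 2, the place \<open>k - 1\<close> exists in
      each of the first \<open>m\<close> blocks.\<close>
    using k by (auto simp: block_elems_def)
  finally show "(\<forall>p. 1 \<le> p \<and> p + 2 \<le> N \<and> k dvd p + 1 \<longrightarrow> \<pi> (p + 2) < \<pi> p) \<longleftrightarrow>
    (\<forall>(x, y)\<in>{((i + 1, 1), (i, k - 1)) | i.
      1 \<le> i \<and> i \<le> m \<and> (i, k - 1) \<in> block_elems m s k}. \<pi> (block_pos k x) \<le> \<pi> (block_pos k y))" .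
qed

lemma card_avoiding_213:
  "card (desc_perms_avoiding N k [2, 1, 3]) = LE (block_elems m s k) (poset213 m s k)"
  unfolding avoiding_213[OF k] poset213_def
proof (rule card_restricted_des_perms)
  show "{((i + 1, 2), (i, k)) | i. 1 \<le> i \<and> i \<le> m \<and> (i + 1, 2) \<in> block_elems m s k}
      \<subseteq> block_elems m s k \<times> block_elems m s k"
    using k by (auto simp: block_elems_def)
next
  fix \<pi> assume \<pi>: "\<pi> permutes {1..N}"
  \<comment> \<open>A valley window starts at \<open>i * k\<close> and ends at the second place of
    the next block. That place is missing only if \<open>i = m\<close> and
    \<open>s = 1\<close>.\<close>
  have bound: "(i + 1, 2) \<in> block_elems m s k \<longleftrightarrow> i * k + 2 \<le> N" if i: "1 \<le> i" "i \<le> m" for i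
  proof (cases "i = m")
    case True
    then show ?thesis using N by (auto simp: block_elems_def)
  next
    case False
    then have "Suc i * k \<le> m * k" using i by (intro mult_le_mono1) simp
    then show ?thesis using False i k N by (auto simp: block_elems_def)
  qed
  have "(\<forall>p. 1 \<le> p \<and> p + 2 \<le> N \<and> k dvd p \<longrightarrow> \<pi> (p + 2) < \<pi> p) \<longleftrightarrow>
      (\<forall>p. 1 \<le> p \<and> p < N \<and> k dvd p \<longrightarrow> p + 2 \<le> N \<longrightarrow> \<pi> (p + 2) \<le> \<pi> p)"
    using permutes_neq[OF \<pi>, of "_ + 2" "_"] by (auto simp: order.strict_iff_order)
  also have "\<dots> \<longleftrightarrow>
      (\<forall>i. 1 \<le> i \<and> i \<le> m \<longrightarrow> i * k + 2 \<le> N \<longrightarrow> \<pi> (i * k + 2) \<le> \<pi> (i * k))"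
    unfolding dvd_less_iff by blast
  also have "\<dots> \<longleftrightarrow> (\<forall>i. 1 \<le> i \<and> i \<le> m \<longrightarrow> (i + 1, 2) \<in> block_elems m s k \<longrightarrow>
      \<pi> (block_pos k (i + 1, 2)) \<le> \<pi> (block_pos k (i, k)))"
  proof (intro all_cong)
    fix i assume i: "1 \<le> i \<and> i \<le> m"
    then have "block_pos k (i, k) = i * k" "block_pos k (i + 1, 2) = i * k + 2"
      by (cases i; simp add: block_pos_def)+
    then show "(i * k + 2 \<le> N \<longrightarrow> \<pi> (i * k + 2) \<le> \<pi> (i * k)) \<longleftrightarrow>
      ((i + 1, 2) \<in> block_elems m s k \<longrightarrow>
        \<pi> (block_pos k (i + 1, 2)) \<le> \<pi> (block_pos k (i, k)))"
      using bound[of i] i by simp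
  qed
  also have "\<dots> \<longleftrightarrow> (\<forall>(x, y)\<in>{((i + 1, 2), (i, k)) | i.
      1 \<le> i \<and> i \<le> m \<and> (i + 1, 2) \<in> block_elems m s k}. \<pi> (block_pos k x) \<le> \<pi> (block_pos k y))"
    by auto
  finally show "(\<forall>p. 1 \<le> p \<and> p + 2 \<le> N \<and> k dvd p \<longrightarrow> \<pi> (p + 2) < \<pi> p) \<longleftrightarrow>
    (\<forall>(x, y)\<in>{((i + 1, 2), (i, k)) | i.
      1 \<le> i \<and> i \<le> m \<and> (i + 1, 2) \<in> block_elems m s k}. \<pi> (block_pos k x) \<le> \<pi> (block_pos k y))" .
qed

section \<open>Product formulas for 231 and 312\<close>

lemma no_adjacent_multiples: "i \<in> {i. k dvd i} \<Longrightarrow> i + 1 \<notin> {i. k dvd i}"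
  using k dvd_add_right_iff[of k i 1] by auto

lemma card_avoiding_231: "card (desc_perms_avoiding N k [2, 3, 1]) = (\<Prod>j<m. s + j * k)"
proof -
  have "card (desc_perms_avoiding N k [2, 3, 1]) = (\<Prod>d\<in>{i. k dvd i} \<inter> {1..<N}. N - d)"
    unfolding avoiding_231[OF k]
    by (rule card_des_perms_231[OF no_adjacent_multiples]) (use s N in auto)
  also have "\<dots> = (\<Prod>j\<in>{1..m}. N - k * j)"
    unfolding multiples_below using k by (subst prod.reindex) (auto simp: inj_on_def)
  also have "\<dots> = (\<Prod>j<m. s + j * k)"
  \<comment> \<open>The factor \<open>N - k * j\<close> is \<open>s + (m - j) * k\<close>, so the
    product is read in reverse order.\<close>
  proof (rule prod.reindex_bij_witness[where i = "\<lambda>j. m - j" and j = "\<lambda>j. m - j"])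
    fix j assume "j \<in> {1..m}"
    then obtain i where "m = i + j" by (metis atLeastAtMost_iff le_add_diff_inverse2)
    then show "s + (m - j) * k = N - k * j" using N by (simp add: algebra_simps)
  qed auto
  finally show ?thesis .
qed

lemma card_avoiding_312: "card (desc_perms_avoiding N k [3, 1, 2]) = k ^ m * fact m"
proof -
  \<comment> \<open>0 is a multiple of \<open>k\<close> but may not belong to the set in
    \<open>card_des_perms_312\<close>; restricting to \<open>{1..<N}\<close> removes it without
    changing the permutations.\<close>
  have "des_perms_312 N {i. k dvd i} = des_perms_312 N ({i. k dvd i} \<inter> {1..<N})"
    by (auto simp: des_perms_312_def des_perms_def)
  then have "card (desc_perms_avoiding N k [3, 1, 2]) =
      card (des_perms_312 N ({i. k dvd i} \<inter> {1..<N}))"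
    unfolding avoiding_312[OF k] by simp
  also have "\<dots> = \<Prod>({i. k dvd i} \<inter> {1..<N} \<inter> {1..<N})"
    by (rule card_des_perms_312) (use no_adjacent_multiples s N in auto)
  also have "\<dots> = (\<Prod>j\<in>{1..m}. k * j)"
    unfolding Int_assoc Int_absorb unfolding multiples_below
    using k by (simp add: prod.reindex inj_on_def)
  also have "\<dots> = k ^ m * fact m"
    by (simp add: prod.distrib fact_prod)
  finally show ?thesis .
qed

end

theorem theorem4p1:
  fixes k m s N :: nat
  assumes "k \<ge> 2" and "1 \<le> s" and "s \<le> k" and "N = m * k + s"
  shows
    "((k \<ge> 3 \<and> N \<ge> 3 \<longrightarrow> card (desc_perms_avoiding N k [1, 2, 3]) = 0) \<and>
      (N < 3 \<or> k = 2 \<longrightarrow> desc_perms_avoiding N k [1, 2, 3] = desc_perms N k)) \<and>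
     card (desc_perms_avoiding N k [3, 2, 1]) = card (desc_perms N k) \<and>
     card (desc_perms_avoiding N k [3, 1, 2]) = k ^ m * fact m \<and>
     card (desc_perms_avoiding N k [2, 3, 1]) = (\<Prod>j<m. s + j * k) \<and>
     card (desc_perms_avoiding N k [1, 3, 2]) = LE (block_elems m s k) (poset132 m s k) \<and>
     card (desc_perms_avoiding N k [2, 1, 3]) = LE (block_elems m s k) (poset213 m s k)"
  using avoiding_123[OF assms(1), of N] avoiding_321[OF assms(1), of N]
    card_avoiding_312[OF assms] card_avoiding_231[OF assms]
    card_avoiding_132[OF assms] card_avoiding_213[OF assms]
  by auto

end
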